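(* Let $\ell\ge1$. The robust multiplication protocol $\Pi_{\mathsf{Mult}}(\mathsf a,\mathsf b,\mathsf{isTr})$ of Tetrad-R (described in the context) on $[\![\cdot]\!]$-shared inputs $\mathsf a,\mathsf b\in\mathbb Z_{2^\ell}$, for either value of the truncation bit $\mathsf{isTr}\in\{0,1\}$, requires (in the amortized sense) $2\ell$ bits of communication in the preprocessing phase, and $1$ round and $3\ell$ bits of communication in the online phase.
   Context: Setting: four parties $P_0,P_1,P_2,P_3$ with pairwise private authenticated synchronous channels; every subset of at least two parties holds a common pseudorandom-function key (one-time setup), so any such subset can sample common random elements without communication. $\mathsf H$ is a collision-resistant hash function with output of fixed length; $\kappa$ is a fixed security parameter. For $\mathsf x\in\mathbb Z_{2^\ell}$, $\mathsf x^{\mathsf t}$ is $\mathsf x$ (as a signed two's complement integer) truncated by a fixed number of low-order bits. Sharing: $\mathsf{v}\in\mathbb{Z}_{2^\ell}$ is $[\![\cdot]\!]$-shared via $\lambda^1_{\mathsf v},\lambda^2_{\mathsf v},\lambda^3_{\mathsf v}$ and $\mathsf{m}_{\mathsf v}=\mathsf v+\lambda_{\mathsf v}$, $\lambda_{\mathsf v}=\lambda^1_{\mathsf v}+\lambda^2_{\mathsf v}+\lambda^3_{\mathsf v}$, where $P_0$ holds $(\lambda^1_{\mathsf v},\lambda^2_{\mathsf v},\lambda^3_{\mathsf v})$, $P_1$ holds $(\mathsf m_{\mathsf v},\lambda^1_{\mathsf v},\lambda^3_{\mathsf v})$, $P_2$ holds $(\mathsf m_{\mathsf v},\lambda^2_{\mathsf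 v},\lambda^3_{\mathsf v})$, $P_3$ holds $(\mathsf m_{\mathsf v},\lambda^1_{\mathsf v},\lambda^2_{\mathsf v})$. The sharing is linear. Robust joint-send: "$P_i,P_j$ $\mathsf{jsnd}$ $\mathsf x$ to $P_k$", with $P_l$ the fourth party. Send: $P_i$ sends $\mathsf x$ to $P_k$. Verify: $P_j$ sends $\mathsf H(\mathsf x)$ to $P_k$; $P_k$ sends to all a bit telling whether the values were inconsistent; $P_i,P_j,P_l$ exchange this bit and take the majority; if the majority is $1$, $P_l$ becomes trusted third party. Verify is executed once, at the end, for all instances together (with one hash of the concatenated messages). Joint sharing $\Pi_{\mathsf{JSh}}$: For a pair containing $P_0$ (preprocessing): $(P_0,P_1)$: $P_0,P_1,P_3$ sample $\lambda^1_{\mathsf v}$; $\lambda^2_{\mathsf v}=\mathsf m_{\mathsf v}=0$; $P_0,P_1$ $\mathsf{jsnd}$ $\lambda^3_{\mathsf v}=-\mathsf v-\lambda^1_{\mathsf v}$ to $P_2$. $(P_0,P_2)$: $P_0,P_1,P_2$ sample $\lambda^3_{\mathsf v}$; $\lambda^1_{\mathsf v}=\mathsf m_{\mathsf v}=0$; $P_0,P_2$ $\mathsf{jsnd}$ $\lambda^2_{\mathsf v}=-\mathsf v-\lambda^3_{\mathsf v}$ to $P_3$. $(P_0,P_3)$: $P_0,P_2,P_3$ sample $\lambda^2_{\mathsf v}$; $\lambda^3_{\mathsf v}=\mathsf m_{\mathsf v}=0$; $P_0,P_3$ $\mathsf{jsnd}$ $\lambda^1_{\mathsf v}=-\mathsf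 v-\lambda^2_{\mathsf v}$ to $P_1$. For $(P_1,P_2)$ (online): in preprocessing the $\lambda$-shares are sampled non-interactively so that $P_1,P_2$ both know all of $\lambda_{\mathsf v}$; online $P_1,P_2$ $\mathsf{jsnd}$ $\mathsf m_{\mathsf v}=\mathsf v+\lambda_{\mathsf v}$ to $P_3$. Protocol $\Pi_{\mathsf{Mult}}(\mathsf a,\mathsf b,\mathsf{isTr})$ for $\mathsf z=\mathsf{ab}$. Preprocessing: (1) Locally, $P_0,P_1$ compute $\gamma^1=\lambda_{\mathsf a}^1\lambda_{\mathsf b}^3+\lambda_{\mathsf a}^3\lambda_{\mathsf b}^1+\lambda_{\mathsf a}^3\lambda_{\mathsf b}^3$; $P_0,P_2$ compute $\gamma^2=\lambda_{\mathsf a}^2\lambda_{\mathsf b}^3+\lambda_{\mathsf a}^3\lambda_{\mathsf b}^2+\lambda_{\mathsf a}^2\lambda_{\mathsf b}^2$; $P_0,P_3$ compute $\gamma^3=\lambda_{\mathsf a}^1\lambda_{\mathsf b}^2+\lambda_{\mathsf a}^2\lambda_{\mathsf b}^1+\lambda_{\mathsf a}^1\lambda_{\mathsf b}^1$. (2) $P_0,P_3,P_j$ sample random $\mathsf u^j\in\mathbb Z_{2^\ell}$, $j\in\{1,2\}$. (3) $P_0,P_3$ compute $\mathsf r=\gamma^3-\mathsf u^1-\mathsf u^2$, set $\mathsf q=\mathsf r^{\mathsf t}$ if $\mathsf{isTr}=1$ and $\mathsf q=\mathsf r$ otherwise, and execute $\Pi_{\mathsf{JSh}}(P_0,P_3,\mathsf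 q)$. (4) $P_0,P_1,P_2$ sample random $\mathsf s_1,\mathsf s_2$ and set $\mathsf s=\mathsf s_1+\mathsf s_2$; $P_0$ sends $\mathsf w=\gamma^1+\gamma^2+\mathsf s$ to $P_3$. Put $\mathsf w^1=\gamma^1+\mathsf s_1$ (known to $P_0,P_1$) and $\mathsf w^2=\gamma^2+\mathsf s_2$ (known to $P_0,P_2$). (5) Check $\Pi_{\mathsf{VrfyP0}}$, run once for all $M$ multiplications of the computation, with values $\mathsf w_j,\mathsf w^1_j,\mathsf w^2_j$, $1\le j\le M$: repeat $\kappa$ times in parallel: all parties non-interactively sample $\tau_1,\dots,\tau_M\in\mathbb Z_{2^\ell}$; $\mathsf e^1=\sum_j\tau_j\mathsf w_j^1$, $\mathsf e^2=\sum_j\tau_j\mathsf w_j^2$, $\mathsf e=\sum_j\tau_j\mathsf w_j$ are joint-shared by $(P_0,P_1)$, $(P_0,P_2)$, $(P_0,P_3)$ respectively using $\Pi_{\mathsf{JSh}}$; $\mathsf g=\mathsf e-\mathsf e^1-\mathsf e^2$ is robustly reconstructed (each party's missing share is sent to it by the three other parties holding it, possibly with hashes, and the majority is taken) and checked to be $0$. If some check fails, $P_0$ is corrupt and $P_1$ becomes trusted third party. Online: (1) $P_1$ computes $\mathsf y_1=-\lambda_{\mathsf a}^1\mathsf m_{\mathsf b}-\lambda_{\mathsf b}^1\mathsf m_{\mathsf a}+\gamma^1+\mathsf u^1$; $P_2$ computes $\mathsf y_2=-\lambda_{\mathsf a}^2\mathsf m_{\mathsf b}-\lambda_{\mathsf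 b}^2\mathsf m_{\mathsf a}+\gamma^2+\mathsf u^2$; both compute $\mathsf y_3=-\lambda_{\mathsf a}^3\mathsf m_{\mathsf b}-\lambda_{\mathsf b}^3\mathsf m_{\mathsf a}$. (2) $P_1$ sends $\mathsf y_1$ to $P_2$, $P_2$ sends $\mathsf y_2$ to $P_1$; they compute $\mathsf z-\mathsf r=\mathsf y_1+\mathsf y_2+\mathsf y_3+\mathsf m_{\mathsf a}\mathsf m_{\mathsf b}$. (3) They set $\mathsf p=(\mathsf z-\mathsf r)^{\mathsf t}$ if $\mathsf{isTr}=1$, else $\mathsf p=\mathsf z-\mathsf r$, and execute $\Pi_{\mathsf{JSh}}(P_1,P_2,\mathsf p)$. (4) Output $[\![\mathsf p]\!]+[\![\mathsf q]\!]$. (5) Verification: $P_3$ computes $\mathsf v=-(\lambda_{\mathsf a}^1+\lambda_{\mathsf a}^2)\mathsf m_{\mathsf b}-(\lambda_{\mathsf b}^1+\lambda_{\mathsf b}^2)\mathsf m_{\mathsf a}+\mathsf u^1+\mathsf u^2+\mathsf w$ and sends $\mathsf H(\mathsf v)$ to $P_1,P_2$, who compare it with $\mathsf H(\mathsf y_1+\mathsf y_2+\mathsf s)$; on mismatch $P_0$ becomes trusted third party. Cost convention (amortized): costs are for executions in which no trusted third party gets established. Communication is the limit, as the number $M$ of multiplications tends to infinity (with $\ell,\kappa$ fixed), of (total bits sent)$/M$, where all hash messages, $\mathsf{jsnd}$ verifications and $\Pi_{\mathsf{VrfyP0}}$ are executed once for the whole computation. The communication to $P_3$ in $\Pi_{\mathsf{JSh}}(P_1,P_2,\mathsf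 p)$ is deferred to the verification stage at the end of the computation; its bits are counted in the online communication, but the rounds of the one-time verification stage are not counted. *)

theory Defs
  imports Complex_Main "HOL-Library.Word" "HOL-Library.State_Monad"
begin

declare [[typedef_overloaded]]

text \<open>
  The ring of integers modulo \<open>2 ^ \<ell>\<close> is the type \<^typ>\<open>'l::len word\<close> with \<open>\<ell> = LENGTH('l)\<close>, and
  hash values are of type \<^typ>\<open>'h::len word\<close>, so that \<open>LENGTH('h)\<close> is the fixed output length of the
  hash function. The class \<^class>\<open>len\<close> is exactly the class of positive lengths.
\<close>

datatype party = P0 | P1 | P2 | P3

datatype phase = Preprocessing | Online

text \<open>\<open>Verification\<close> marks everything that is deferred to the one-time checks ending a phase.\<close>

datatype stage = Main | Verification


subsection \<open>Values held by parties\<close>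

text \<open>
  A distributed value \<open>X\<close> says which parties know the value (the domain of \<open>X\<close>), and for each of
  them its own copy, together with the communication round, counted from the start of the current
  phase, after which that copy is available (\<open>0\<close> if no communication is needed). Copies of different
  parties may differ if somebody misbehaves. A party can compute locally only from copies it holds,
  and a computed copy is available as soon as all its arguments are. Hence holders and rounds are
  consequences of the data flow of a protocol, not annotations.
\<close>

type_synonym 'a held = "party \<rightharpoonup> nat \<times> 'a"

definition among :: "party set \<Rightarrow> 'a \<Rightarrow> 'a held" where
  "among S x = (\<lambda>p. if p \<in> S then Some (0, x) else None)"

definition hmap :: "('a \<Rightarrow> 'b) \<Rightarrow> 'a held \<Rightarrow> 'b held" where
  "hmap f X = (\<lambda>p. map_option (\<lambda>(t, x). (t, f x)) (X p))"

definition hmap2 :: "('a \<Rightarrow> 'b \<Rightarrow> 'c) \<Rightarrow> 'a held \<Rightarrow> 'b held \<Rightarrow> 'c held" where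
  "hmap2 f X Y = (\<lambda>p. case (X p, Y p) of
     (Some (t, x), Some (t', y)) \<Rightarrow> Some (max t t', f x y) | _ \<Rightarrow> None)"

definition hlist :: "'a held list \<Rightarrow> 'a list held" where
  "hlist Xs = foldr (hmap2 (#)) Xs (among UNIV [])"

abbreviation hadd :: "'a::plus held \<Rightarrow> 'a held \<Rightarrow> 'a held" (infixl "\<oplus>" 65) where
  "X \<oplus> Y \<equiv> hmap2 (+) X Y"

abbreviation hminus :: "'a::minus held \<Rightarrow> 'a held \<Rightarrow> 'a held" (infixl "\<ominus>" 65) where
  "X \<ominus> Y \<equiv> hmap2 (-) X Y"

abbreviation htimes :: "'a::times held \<Rightarrow> 'a held \<Rightarrow> 'a held" (infixl "\<otimes>" 70) where
  "X \<otimes> Y \<equiv> hmap2 (*) X Y"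

definition hsum :: "'a::comm_monoid_add held list \<Rightarrow> 'a held" where
  "hsum Xs = foldr hadd Xs (among UNIV 0)"

text \<open>Everything known at the end of the preprocessing is available when the online phase starts.\<close>

definition restart_clock :: "'a held \<Rightarrow> 'a held" where
  "restart_clock X = (\<lambda>p. map_option (\<lambda>(t, x). (0, x)) (X p))"


subsection \<open>Messages and executions\<close>

datatype ('l, 'h) payload = Elem "'l word" | Digest "'h word" | Flag bool

definition word_bits :: "'l::len word \<Rightarrow> bool list" where
  "word_bits w = map (bit w) [0..<LENGTH('l)]"

fun payload_bits :: "('l::len, 'h::len) payload \<Rightarrow> bool list" where
  "payload_bits (Elem x) = word_bits x"
| "payload_bits (Digest y) = word_bits y"
| "payload_bits (Flag b) = [b]"

record ('l, 'h) msg =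
  msg_phase :: phase
  msg_stage :: stage
  msg_round :: nat
  sender :: party
  receiver :: party
  content :: "('l, 'h) payload"

text \<open>
  The messages sent so far in chronological order, and the trusted third party, if one has been
  established.
\<close>

record ('l, 'h) net =
  sent :: "('l, 'h) msg list"
  ttp :: "party option"

text \<open>
  Corrupt parties send arbitrary values of the prescribed format: the value of their message is a
  function of the number of messages sent before, which, as all such functions are considered,
  covers every adaptive strategy. \<open>accuses p\<close> tells whether a corrupt \<open>p\<close> reports a mismatch in the
  online verification.
\<close>

record ('l, 'h) adversary =
  corrupt :: "party set"
  forged_elem :: "nat \<Rightarrow> 'l word"
  forged_digest :: "nat \<Rightarrow> 'h word"
  forged_flag :: "nat \<Rightarrow> bool"
  accuses :: "party \<Rightarrow> bool"

text \<open>
  Party \<open>i\<close> sends its copy of \<open>X\<close> to \<open>k\<close>, in the round following the one after which that copy is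
  available; the result is the copy received by \<open>k\<close>. The protocol ends as soon as a trusted third
  party is established, so nothing is sent any more after that.
\<close>

definition send ::
  "('l, 'h) adversary \<Rightarrow> (nat \<Rightarrow> 'a) \<Rightarrow> ('a \<Rightarrow> ('l, 'h) payload) \<Rightarrow> phase \<Rightarrow> stage \<Rightarrow> party \<Rightarrow> party
    \<Rightarrow> 'a held \<Rightarrow> (('l, 'h) net, 'a held) state" where
  "send A forged c ph st i k X = State (\<lambda>N.
     case X i of
       None \<Rightarrow> (Map.empty, N)
     | Some (t, x) \<Rightarrow>
         if ttp N \<noteq> None then (Map.empty, N)
         else let y = (if i \<in> corrupt A then forged (length (sent N)) else x) in
           ([k \<mapsto> (Suc t, y)],
            N\<lparr>sent := sent N @
               [\<lparr>msg_phase = ph, msg_stage = st, msg_round = Suc t, sender = i, receiver = k,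
                 content = c y\<rparr>]\<rparr>))"

abbreviation "send_elem A \<equiv> send A (forged_elem A) Elem"
abbreviation "send_digest A \<equiv> send A (forged_digest A) Digest"
abbreviation "send_flag A \<equiv> send A (forged_flag A) Flag"

definition establish :: "party \<Rightarrow> bool \<Rightarrow> (('l, 'h) net, unit) state" where
  "establish p b =
     State (\<lambda>N. ((), if b \<and> ttp N = None then N\<lparr>ttp := Some p\<rparr> else N))"

definition noticed :: "('l, 'h) adversary \<Rightarrow> party set \<Rightarrow> bool held \<Rightarrow> bool" where
  "noticed A S B \<longleftrightarrow> (\<exists>p\<in>S - corrupt A. \<exists>t. B p = Some (t, True))"


subsection \<open>Parameters and common randomness\<close>

record 'h params =
  hash_fun :: "bool list \<Rightarrow> 'h word"
  kappa :: nat
  trunc_bits :: nat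
  rec_hash :: bool  \<comment> \<open>whether robust reconstruction replaces one of the three values by its hash\<close>

text \<open>
  Outcomes of the non-interactive sampling. The first argument is the index of the multiplication,
  except for the last four components, where it is the index of the repetition of the check of \<open>P0\<close>;
  the second argument of \<open>tau\<close> is the index of the multiplication.
\<close>

record 'l coins =
  u1_coin :: "nat \<Rightarrow> 'l word"
  u2_coin :: "nat \<Rightarrow> 'l word"
  s1_coin :: "nat \<Rightarrow> 'l word"
  s2_coin :: "nat \<Rightarrow> 'l word"
  q_coin :: "nat \<Rightarrow> 'l word"
  p1_coin :: "nat \<Rightarrow> 'l word"
  p2_coin :: "nat \<Rightarrow> 'l word"
  p3_coin :: "nat \<Rightarrow> 'l word"
  tau :: "nat \<Rightarrow> nat \<Rightarrow> 'l word"
  e1_coin :: "nat \<Rightarrow> 'l word"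
  e2_coin :: "nat \<Rightarrow> 'l word"
  e_coin :: "nat \<Rightarrow> 'l word"

definition hhash :: "'h params \<Rightarrow> 'l::len word held list \<Rightarrow> 'h word held" where
  "hhash Q Xs = hmap (\<lambda>xs. hash_fun Q (concat (map word_bits xs))) (hlist Xs)"


subsection \<open>Sharing\<close>

record 'l sharing =
  lam1 :: "'l word held"
  lam2 :: "'l word held"
  lam3 :: "'l word held"
  masked :: "'l word held"

definition sharing_of :: "'l::len word \<Rightarrow> 'l sharing \<Rightarrow> bool" where
  "sharing_of v S \<longleftrightarrow> (\<exists>l1 l2 l3. S =
     \<lparr>lam1 = among {P0, P1, P3} l1, lam2 = among {P0, P2, P3} l2, lam3 = among {P0, P1, P2} l3,
      masked = among {P1, P2, P3} (v + (l1 + l2 + l3))\<rparr>)"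

definition sharing_map2 ::
  "('l word held \<Rightarrow> 'l word held \<Rightarrow> 'l word held) \<Rightarrow> 'l sharing \<Rightarrow> 'l sharing \<Rightarrow> 'l sharing" where
  "sharing_map2 f S T =
     \<lparr>lam1 = f (lam1 S) (lam1 T), lam2 = f (lam2 S) (lam2 T), lam3 = f (lam3 S) (lam3 T),
      masked = f (masked S) (masked T)\<rparr>"


subsection \<open>Robust joint-send\<close>

text \<open>
  The sending part of \<open>P\<^sub>i, P\<^sub>j\<close> \<open>jsnd\<close> \<open>X\<close> \<open>to\<close> \<open>P\<^sub>k\<close> is \<^term>\<open>send_elem A ph st i k X\<close>. An instance is
  recorded as the pair of \<open>X\<close> and the received copy, and all instances with the same parties
  are verified together.
\<close>

definition maj3 :: "'a \<Rightarrow> 'a \<Rightarrow> 'a \<Rightarrow> 'a" where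
  "maj3 x y z = (if x = y \<or> x = z then x else y)"

definition hmaj3 :: "'a held \<Rightarrow> 'a held \<Rightarrow> 'a held \<Rightarrow> 'a held" where
  "hmaj3 X Y Z = hmap2 (\<lambda>f z. f z) (hmap2 maj3 X Y) Z"

definition jsnd_verify ::
  "'h params \<Rightarrow> ('l::len, 'h) adversary \<Rightarrow> phase \<Rightarrow> party \<Rightarrow> party \<Rightarrow> party \<Rightarrow> party
    \<Rightarrow> ('l word held \<times> 'l word held) list \<Rightarrow> (('l, 'h) net, unit) state" where
  "jsnd_verify Q A ph i j k l insts = do {
     d \<leftarrow> send_digest A ph Verification j k (hhash Q (map fst insts));
     let b = hmap2 (\<noteq>) d (hhash Q (map snd insts));
     bi \<leftarrow> send_flag A ph Verification k i b;
     bj \<leftarrow> send_flag A ph Verification k j b;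
     bl \<leftarrow> send_flag A ph Verification k l b;
     bij \<leftarrow> send_flag A ph Verification i j bi;
     bil \<leftarrow> send_flag A ph Verification i l bi;
     bji \<leftarrow> send_flag A ph Verification j i bj;
     bjl \<leftarrow> send_flag A ph Verification j l bj;
     bli \<leftarrow> send_flag A ph Verification l i bl;
     blj \<leftarrow> send_flag A ph Verification l j bl;
     let m = hmaj3 (bi ++ bj ++ bl) (bji ++ bij ++ bil) (bli ++ blj ++ bjl);
     establish l (noticed A {i, j, l} m)
   }"


subsection \<open>Joint sharing\<close>

text \<open>
  Each of these returns the sharing and the joint-send instance to be verified later. In \<open>X ++ Y\<close>
  the received copy \<open>Y\<close> complements the copies \<open>X\<close> computed by the two joint senders.
\<close>

definition jsh01 ::
  "('l::len, 'h) adversary \<Rightarrow> stage \<Rightarrow> 'l word \<Rightarrow> 'l word held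
    \<Rightarrow> (('l, 'h) net, 'l sharing \<times> ('l word held \<times> 'l word held)) state" where
  "jsh01 A st c V = do {
     let l1 = among {P0, P1, P3} c;
     let l3 = hmap uminus V \<ominus> l1;
     y \<leftarrow> send_elem A Preprocessing st P0 P2 l3;
     State_Monad.return
       (\<lparr>lam1 = l1, lam2 = among {P0, P2, P3} 0, lam3 = l3 ++ y, masked = among {P1, P2, P3} 0\<rparr>,
        (l3, y))
   }"

definition jsh02 ::
  "('l::len, 'h) adversary \<Rightarrow> stage \<Rightarrow> 'l word \<Rightarrow> 'l word held
    \<Rightarrow> (('l, 'h) net, 'l sharing \<times> ('l word held \<times> 'l word held)) state" where
  "jsh02 A st c V = do {
     let l3 = among {P0, P1, P2} c;
     let l2 = hmap uminus V \<ominus> l3;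
     y \<leftarrow> send_elem A Preprocessing st P0 P3 l2;
     State_Monad.return
       (\<lparr>lam1 = among {P0, P1, P3} 0, lam2 = l2 ++ y, lam3 = l3, masked = among {P1, P2, P3} 0\<rparr>,
        (l2, y))
   }"

definition jsh03 ::
  "('l::len, 'h) adversary \<Rightarrow> stage \<Rightarrow> 'l word \<Rightarrow> 'l word held
    \<Rightarrow> (('l, 'h) net, 'l sharing \<times> ('l word held \<times> 'l word held)) state" where
  "jsh03 A st c V = do {
     let l2 = among {P0, P2, P3} c;
     let l1 = hmap uminus V \<ominus> l2;
     y \<leftarrow> send_elem A Preprocessing st P0 P1 l1;
     State_Monad.return
       (\<lparr>lam1 = l1 ++ y, lam2 = l2, lam3 = among {P0, P1, P2} 0, masked = among {P1, P2, P3} 0\<rparr>,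
        (l1, y))
   }"

text \<open>
  For \<open>P1\<close> and \<open>P2\<close> the \<open>\<lambda>\<close>-shares \<open>l1\<close>, \<open>l2\<close>, \<open>l3\<close> have been sampled in the preprocessing. The
  message to \<open>P3\<close> belongs to the online phase but is deferred to its verification stage.
\<close>

definition jsh12 ::
  "('l::len, 'h) adversary \<Rightarrow> 'l word held \<Rightarrow> 'l word held \<Rightarrow> 'l word held \<Rightarrow> 'l word held
    \<Rightarrow> (('l, 'h) net, 'l sharing \<times> ('l word held \<times> 'l word held)) state" where
  "jsh12 A l1 l2 l3 V = do {
     let m = V \<oplus> (l1 \<oplus> l2 \<oplus> l3);
     y \<leftarrow> send_elem A Online Verification P1 P3 m;
     State_Monad.return (\<lparr>lam1 = l1, lam2 = l2, lam3 = l3, masked = m ++ y\<rparr>, (m, y))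
   }"


subsection \<open>Robust reconstruction\<close>

text \<open>
  \<open>X\<close> is held by \<open>i\<close>, \<open>j\<close>, \<open>l\<close> and made known to \<open>k\<close>. With hashes, two values and one hash are sent:
  if the two values agree, they are the majority; otherwise the hash decides between them.
\<close>

definition rec_share ::
  "'h params \<Rightarrow> ('l::len, 'h) adversary \<Rightarrow> phase \<Rightarrow> party \<Rightarrow> party \<Rightarrow> party \<Rightarrow> party
    \<Rightarrow> 'l word held \<Rightarrow> (('l, 'h) net, 'l word held) state" where
  "rec_share Q A ph i j l k X = do {
     x \<leftarrow> send_elem A ph Verification i k X;
     y \<leftarrow> send_elem A ph Verification j k X;
     if rec_hash Q then do {
       d \<leftarrow> send_digest A ph Verification l k (hhash Q [X]);
       let x_ok = hmap2 (=) (hhash Q [x]) d;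
       State_Monad.return (hmap2 (\<lambda>(v, v') b. if v = v' \<or> b then v else v') (hmap2 Pair x y) x_ok)
     } else do {
       z \<leftarrow> send_elem A ph Verification l k X;
       State_Monad.return (hmaj3 x y z)
     }
   }"

definition reconstruct ::
  "'h params \<Rightarrow> ('l::len, 'h) adversary \<Rightarrow> phase \<Rightarrow> 'l sharing
    \<Rightarrow> (('l, 'h) net, 'l word held) state" where
  "reconstruct Q A ph S = do {
     m \<leftarrow> rec_share Q A ph P1 P2 P3 P0 (masked S);
     l2 \<leftarrow> rec_share Q A ph P0 P2 P3 P1 (lam2 S);
     l1 \<leftarrow> rec_share Q A ph P0 P1 P3 P2 (lam1 S);
     l3 \<leftarrow> rec_share Q A ph P0 P1 P2 P3 (lam3 S);
     State_Monad.return
       ((masked S ++ m) \<ominus> ((lam1 S ++ l1) \<oplus> (lam2 S ++ l2) \<oplus> (lam3 S ++ l3)))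
   }"


subsection \<open>Multiplication: preprocessing\<close>

record 'l gate =
  inA :: "'l sharing"
  inB :: "'l sharing"
  isTr :: bool

definition trunc_if :: "'h params \<Rightarrow> 'l::len gate \<Rightarrow> 'l word held \<Rightarrow> 'l word held" where
  "trunc_if Q g X = (if isTr g then hmap (signed_drop_bit (trunc_bits Q)) X else X)"

definition gamma1 :: "'l::len gate \<Rightarrow> 'l word held" where
  "gamma1 g = lam1 (inA g) \<otimes> lam3 (inB g) \<oplus> lam3 (inA g) \<otimes> lam1 (inB g) \<oplus> lam3 (inA g) \<otimes> lam3 (inB g)"

definition gamma2 :: "'l::len gate \<Rightarrow> 'l word held" where
  "gamma2 g = lam2 (inA g) \<otimes> lam3 (inB g) \<oplus> lam3 (inA g) \<otimes> lam2 (inB g) \<oplus> lam2 (inA g) \<otimes> lam2 (inB g)"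

definition gamma3 :: "'l::len gate \<Rightarrow> 'l word held" where
  "gamma3 g = lam1 (inA g) \<otimes> lam2 (inB g) \<oplus> lam2 (inA g) \<otimes> lam1 (inB g) \<oplus> lam1 (inA g) \<otimes> lam1 (inB g)"

record 'l prep =
  pre_u1 :: "'l word held"
  pre_u2 :: "'l word held"
  pre_s :: "'l word held"
  pre_w :: "'l word held"
  pre_w1 :: "'l word held"
  pre_w2 :: "'l word held"
  pre_q :: "'l sharing"
  pre_q_inst :: "'l word held \<times> 'l word held"
  pre_p1 :: "'l word held"
  pre_p2 :: "'l word held"
  pre_p3 :: "'l word held"

text \<open>
  \<open>pre_p1\<close>, \<open>pre_p2\<close>, \<open>pre_p3\<close> are the shares of \<open>\<lambda>\<close> for the online joint sharing of \<open>p\<close>; the first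
  two are sampled by all parties, so that both \<open>P1\<close> and \<open>P2\<close> know all three.
\<close>

definition mult_pre ::
  "'h params \<Rightarrow> ('l::len, 'h) adversary \<Rightarrow> 'l coins \<Rightarrow> nat \<times> 'l gate
    \<Rightarrow> (('l, 'h) net, 'l prep) state" where
  "mult_pre Q A C = (\<lambda>(n, g). do {
     let u1 = among {P0, P3, P1} (u1_coin C n);
     let u2 = among {P0, P3, P2} (u2_coin C n);
     let q = trunc_if Q g (gamma3 g \<ominus> u1 \<ominus> u2);
     (sq, inst) \<leftarrow> jsh03 A Main (q_coin C n) q;
     let s1 = among {P0, P1, P2} (s1_coin C n);
     let s2 = among {P0, P1, P2} (s2_coin C n);
     let s = s1 \<oplus> s2;
     let w = gamma1 g \<oplus> gamma2 g \<oplus> s;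
     w' \<leftarrow> send_elem A Preprocessing Main P0 P3 w;
     State_Monad.return
       \<lparr>pre_u1 = u1, pre_u2 = u2, pre_s = s, pre_w = w ++ w',
        pre_w1 = gamma1 g \<oplus> s1, pre_w2 = gamma2 g \<oplus> s2, pre_q = sq, pre_q_inst = inst,
        pre_p1 = among UNIV (p1_coin C n), pre_p2 = among UNIV (p2_coin C n),
        pre_p3 = among {P0, P1, P2} (p3_coin C n)\<rparr>
   })"

record 'l check =
  chk_g :: "'l sharing"
  chk_inst1 :: "'l word held \<times> 'l word held"
  chk_inst2 :: "'l word held \<times> 'l word held"
  chk_inst :: "'l word held \<times> 'l word held"

definition tau_sum :: "'l::len coins \<Rightarrow> nat \<Rightarrow> 'l word held list \<Rightarrow> 'l word held" where
  "tau_sum C r Xs = hsum (map (\<lambda>(n, X). among UNIV (tau C r n) \<otimes> X) (enumerate 0 Xs))"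

definition vrfyP0_share ::
  "('l::len, 'h) adversary \<Rightarrow> 'l coins \<Rightarrow> 'l prep list \<Rightarrow> nat \<Rightarrow> (('l, 'h) net, 'l check) state" where
  "vrfyP0_share A C ps r = do {
     (se1, inst1) \<leftarrow> jsh01 A Verification (e1_coin C r) (tau_sum C r (map pre_w1 ps));
     (se2, inst2) \<leftarrow> jsh02 A Verification (e2_coin C r) (tau_sum C r (map pre_w2 ps));
     (se, inst) \<leftarrow> jsh03 A Verification (e_coin C r) (tau_sum C r (map pre_w ps));
     State_Monad.return
       \<lparr>chk_g = sharing_map2 hminus (sharing_map2 hminus se se1) se2,
        chk_inst1 = inst1, chk_inst2 = inst2, chk_inst = inst\<rparr>
   }"

definition vrfyP0_check ::
  "'h params \<Rightarrow> ('l::len, 'h) adversary \<Rightarrow> 'l check \<Rightarrow> (('l, 'h) net, unit) state" where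
  "vrfyP0_check Q A c = do {
     g \<leftarrow> reconstruct Q A Preprocessing (chk_g c);
     establish P1 (noticed A UNIV (hmap (\<lambda>x. x \<noteq> 0) g))
   }"

text \<open>
  The joint-sends of the preprocessing and of the online phase have different parties, so each
  combination of parties is verified exactly once, at the end of the phase it occurs in.
\<close>

definition preprocessing ::
  "'h params \<Rightarrow> ('l::len, 'h) adversary \<Rightarrow> 'l coins \<Rightarrow> 'l gate list
    \<Rightarrow> (('l, 'h) net, 'l prep list) state" where
  "preprocessing Q A C gs = do {
     ps \<leftarrow> State_Monad.traverse_list (mult_pre Q A C) (enumerate 0 gs);
     cs \<leftarrow> State_Monad.traverse_list (vrfyP0_share A C ps) [0..<kappa Q];
     jsnd_verify Q A Preprocessing P0 P3 P1 P2 (map pre_q_inst ps @ map chk_inst cs);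
     jsnd_verify Q A Preprocessing P0 P1 P2 P3 (map chk_inst1 cs);
     jsnd_verify Q A Preprocessing P0 P2 P3 P1 (map chk_inst2 cs);
     State_Monad.traverse_list (vrfyP0_check Q A) cs;
     State_Monad.return ps
   }"


subsection \<open>Multiplication: online phase\<close>

record 'l online =
  onl_p :: "'l word held"
  onl_y :: "'l word held"  \<comment> \<open>\<open>y1 + y2 + s\<close>\<close>

definition mult_onl ::
  "'h params \<Rightarrow> ('l::len, 'h) adversary \<Rightarrow> 'l gate \<times> 'l prep
    \<Rightarrow> (('l, 'h) net, 'l online) state" where
  "mult_onl Q A = (\<lambda>(g, p). do {
     let a = inA g;
     let b = inB g;
     let y1 = gamma1 g \<oplus> pre_u1 p \<ominus> lam1 a \<otimes> masked b \<ominus> lam1 b \<otimes> masked a;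
     let y2 = gamma2 g \<oplus> pre_u2 p \<ominus> lam2 a \<otimes> masked b \<ominus> lam2 b \<otimes> masked a;
     let y3 = hmap uminus (lam3 a \<otimes> masked b) \<ominus> lam3 b \<otimes> masked a;
     y1' \<leftarrow> send_elem A Online Main P1 P2 y1;
     y2' \<leftarrow> send_elem A Online Main P2 P1 y2;
     let y12 = (y1 ++ y1') \<oplus> (y2 ++ y2');
     let zr = y12 \<oplus> y3 \<oplus> masked a \<otimes> masked b;
     State_Monad.return \<lparr>onl_p = trunc_if Q g zr, onl_y = y12 \<oplus> pre_s p\<rparr>
   })"

definition verify_value :: "'l::len gate \<times> 'l prep \<Rightarrow> 'l word held" where
  "verify_value = (\<lambda>(g, p).
     pre_u1 p \<oplus> pre_u2 p \<oplus> restart_clock (pre_w p)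
       \<ominus> (lam1 (inA g) \<oplus> lam2 (inA g)) \<otimes> masked (inB g)
       \<ominus> (lam1 (inB g) \<oplus> lam2 (inB g)) \<otimes> masked (inA g))"

definition restart_clock_sharing :: "'l sharing \<Rightarrow> 'l sharing" where
  "restart_clock_sharing S =
     \<lparr>lam1 = restart_clock (lam1 S), lam2 = restart_clock (lam2 S),
      lam3 = restart_clock (lam3 S), masked = restart_clock (masked S)\<rparr>"

text \<open>The result is the list of output sharings.\<close>

definition online ::
  "'h params \<Rightarrow> ('l::len, 'h) adversary \<Rightarrow> 'l gate list \<Rightarrow> 'l prep list
    \<Rightarrow> (('l, 'h) net, 'l sharing list) state" where
  "online Q A gs ps = do {
     os \<leftarrow> State_Monad.traverse_list (mult_onl Q A) (zip gs ps);
     js \<leftarrow> State_Monad.traverse_list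
       (\<lambda>(p, r). jsh12 A (pre_p1 p) (pre_p2 p) (pre_p3 p) (onl_p r)) (zip ps os);
     jsnd_verify Q A Online P1 P2 P3 P0 (map snd js);
     let v = hhash Q (map verify_value (zip gs ps));
     d1 \<leftarrow> send_digest A Online Verification P3 P1 v;
     d2 \<leftarrow> send_digest A Online Verification P3 P2 v;
     let mismatch = hmap2 (\<noteq>) (d1 ++ d2) (hhash Q (map onl_y os));
     establish P0 (noticed A {P1, P2} mismatch \<or> (\<exists>p\<in>{P1, P2} \<inter> corrupt A. accuses A p));
     State_Monad.return
       (map (\<lambda>(p, j). sharing_map2 hadd (fst j) (restart_clock_sharing (pre_q p))) (zip ps js))
   }"

text \<open>
  All multiplications of the computation, on given shared inputs, with the one-time checks
  executed once for all of them.
\<close>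

definition mult_protocol ::
  "'h params \<Rightarrow> ('l::len, 'h) adversary \<Rightarrow> 'l coins \<Rightarrow> 'l gate list
    \<Rightarrow> (('l, 'h) net, 'l sharing list) state" where
  "mult_protocol Q A C gs = do {
     ps \<leftarrow> preprocessing Q A C gs;
     online Q A gs ps
   }"

definition execution ::
  "'h params \<Rightarrow> ('l::len, 'h) adversary \<Rightarrow> 'l coins \<Rightarrow> 'l gate list \<Rightarrow> ('l, 'h) net" where
  "execution Q A C gs = snd (run_state (mult_protocol Q A C gs) \<lparr>sent = [], ttp = None\<rparr>)"


subsection \<open>Cost\<close>

definition comm_bits :: "phase \<Rightarrow> ('l::len, 'h::len) net \<Rightarrow> nat" where
  "comm_bits ph N =
     (\<Sum>m\<leftarrow>filter (\<lambda>m. msg_phase m = ph) (sent N). length (payload_bits (content m)))"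

text \<open>The rounds of the one-time verification stage are not counted.\<close>

definition comm_rounds :: "phase \<Rightarrow> ('l, 'h) net \<Rightarrow> nat" where
  "comm_rounds ph N =
     Max (insert 0 (msg_round ` {m \<in> set (sent N). msg_phase m = ph \<and> msg_stage m = Main}))"

end

theory Submission
  imports Defs
begin

text \<open>
  A trusted third party is never removed, so if none is established at the end, every \<^const>\<open>send\<close>
  whose sender holds the value has sent exactly one message. Per multiplication these are two ring
  elements in the preprocessing (a share of \<open>q\<close>, and \<open>w\<close>) and three online (\<open>y\<^sub>1\<close>, \<open>y\<^sub>2\<close> and the masked
  \<open>p\<close>), and \<open>y\<^sub>1\<close> and \<open>y\<^sub>2\<close> are computed from copies available at time \<open>0\<close>. All other messages
  belong to the one-time checks; their number is bounded independently of the number of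
  multiplications, so they vanish in the limit.
\<close>

section \<open>Persistence of an established trusted third party\<close>

definition keeps_ttp :: "(('l, 'h) net, 'a) state \<Rightarrow> bool" where
  "keeps_ttp m \<longleftrightarrow> (\<forall>N. ttp N \<noteq> None \<longrightarrow> ttp (snd (run_state m N)) \<noteq> None)"

lemma keeps_ttp_return: "keeps_ttp (State_Monad.return x)"
  by (simp add: keeps_ttp_def)

lemma keeps_ttp_bind:
  assumes "keeps_ttp m" and "\<And>x. keeps_ttp (f x)"
  shows "keeps_ttp (State_Monad.bind m f)"
  using assms by (auto simp: keeps_ttp_def split: prod.split)

lemma keeps_ttp_send: "keeps_ttp (send A forged c ph st i k X)"
  by (auto simp: keeps_ttp_def send_def Let_def split: option.split)

lemma keeps_ttp_establish: "keeps_ttp (establish p b)"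
  by (auto simp: keeps_ttp_def establish_def)

lemma keeps_ttp_case_prod:
  "(\<And>x y. keeps_ttp (f x y)) \<Longrightarrow> keeps_ttp (case p of (x, y) \<Rightarrow> f x y)"
  by (cases p) simp

lemma keeps_ttp_if: "keeps_ttp m \<Longrightarrow> keeps_ttp m' \<Longrightarrow> keeps_ttp (if b then m else m')"
  by simp

lemma keeps_ttp_traverse_list:
  assumes "\<And>x. keeps_ttp (f x)"
  shows "keeps_ttp (State_Monad.traverse_list f xs)"
  by (induction xs) (auto intro!: keeps_ttp_return keeps_ttp_bind assms)

lemmas keeps_ttp_intros =
  keeps_ttp_return keeps_ttp_bind keeps_ttp_send keeps_ttp_establish keeps_ttp_case_prod
  keeps_ttp_if keeps_ttp_traverse_list

section \<open>Rules for runs that end without a trusted third party\<close>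

text \<open>
  Partial correctness for the runs in which no trusted third party is established. The absence of
  one is known of the end of an execution only; \<^const>\<open>keeps_ttp\<close> carries it back to the intermediate
  states.
\<close>

definition yields ::
  "(('l, 'h) net, 'a) state \<Rightarrow> ('a \<Rightarrow> ('l, 'h) msg list \<Rightarrow> bool) \<Rightarrow> bool" where
  "yields m P \<longleftrightarrow> (\<forall>N x N'. run_state m N = (x, N') \<longrightarrow> ttp N = None \<longrightarrow> ttp N' = None \<longrightarrow>
     (\<exists>ms. sent N' = sent N @ ms \<and> P x ms))"

lemma yields_mono:
  assumes "yields m P" and "\<And>x ms. P x ms \<Longrightarrow> R x ms"
  shows "yields m R"
  using assms unfolding yields_def by blast

lemma yieldsD:
  assumes "yields m P" and "ttp N = None" and "ttp (snd (run_state m N)) = None"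
  shows "\<exists>ms. sent (snd (run_state m N)) = sent N @ ms \<and> P (fst (run_state m N)) ms"
  using assms unfolding yields_def by (metis prod.collapse)

lemma yields_return: "P x [] \<Longrightarrow> yields (State_Monad.return x) P"
  by (simp add: yields_def)

text \<open>The postcondition demanded of \<open>m\<close> is itself a \<open>yields\<close>
  statement about the continuation, as in a weakest-precondition calculus. Repeated use walks
  through a do-block, with \<open>ms\<close> accumulating the messages sent so far.\<close>

lemma yields_bind:
  assumes m: "yields m (\<lambda>x ms. yields (f x) (\<lambda>y ms'. P y (ms @ ms')))"
    and f: "\<And>x. keeps_ttp (f x)"
  shows "yields (State_Monad.bind m f) P"
  unfolding yields_def
proof (intro allI impI)
  fix N y N''
  assume "run_state (State_Monad.bind m f) N = (y, N'')" and N: "ttp N = None" "ttp N'' = None"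
  then obtain x N' where run: "run_state m N = (x, N')" "run_state (f x) N' = (y, N'')"
    by (auto split: prod.splits)
  \<comment> \<open>Contrapositive of \<open>keeps_ttp\<close>: a third party present after
    \<open>m\<close> would still be there after \<open>f x\<close>.\<close>
  have N': "ttp N' = None"
    using f run(2) N(2) unfolding keeps_ttp_def by (metis snd_conv)
  obtain ms where ms: "sent N' = sent N @ ms" "yields (f x) (\<lambda>y ms'. P y (ms @ ms'))"
    using m run(1) N(1) N' unfolding yields_def by blast
  then obtain ms' where "sent N'' = sent N' @ ms'" "P y (ms @ ms')"
    using run(2) N' N(2) unfolding yields_def by blast
  then show "\<exists>ms. sent N'' = sent N @ ms \<and> P y ms"
    using ms(1) by auto
qed

text \<open>With no third party at the end, a sender holding the value does send. The value
  \<open>y\<close> stays arbitrary because a corrupt sender may forge it; the format, and hence the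
  bit length, is fixed by \<open>c\<close>.\<close>

lemma yields_send:
  assumes "X i = Some (t, x)"
    and "\<And>y. P [k \<mapsto> (Suc t, y)] [\<lparr>msg_phase = ph, msg_stage = st, msg_round = Suc t, sender = i,
           receiver = k, content = c y\<rparr>]"
  shows "yields (send A forged c ph st i k X) P"
  using assms by (auto simp: yields_def send_def Let_def)

text \<open>The messages are kept as one block per list element, so that exact costs per
  multiplication can be added up afterwards.\<close>

lemma yields_traverse_list:
  assumes "\<And>x. x \<in> set xs \<Longrightarrow> yields (f x) (\<lambda>y ms. R x y \<and> S ms)" and "\<And>x. keeps_ttp (f x)"
  shows "yields (State_Monad.traverse_list f xs) (\<lambda>ys ms. list_all2 R xs ys \<and>
           (\<exists>mss. ms = concat mss \<and> length mss = length xs \<and> (\<forall>ms\<in>set mss. S ms)))"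
  using assms(1)
proof (induction xs)
  case Nil
  show ?case
    by (auto intro!: yields_return)
next
  case (Cons x xs)
  show ?case
    unfolding State_Monad.traverse_list.simps
  proof (intro yields_bind keeps_ttp_intros assms(2), rule yields_mono)
    show "yields (f x) (\<lambda>y ms. R x y \<and> S ms)"
      by (simp add: Cons.prems)
  next
    fix y ms
    assume y: "R x y \<and> S ms"
    have tail: "yields (State_Monad.traverse_list f xs) (\<lambda>ys ms. list_all2 R xs ys \<and>
           (\<exists>mss. ms = concat mss \<and> length mss = length xs \<and> (\<forall>ms\<in>set mss. S ms)))"
      using Cons.IH Cons.prems by simp
    show "yields (State_Monad.bind (State_Monad.traverse_list f xs)
             (\<lambda>ys. State_Monad.return (y # ys)))
           (\<lambda>ys ms'. list_all2 R (x # xs) ys \<and> (\<exists>mss. ms @ ms' = concat mss \<and>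
              length mss = length (x # xs) \<and> (\<forall>ms\<in>set mss. S ms)))"
      apply (intro yields_bind keeps_ttp_intros)
      apply (rule yields_mono[OF tail])
      apply (rule yields_return)
      using y
      apply clarsimp
      \<comment> \<open>The block of the head is put in front of the blocks of the tail.\<close>
      subgoal for ys mss by (rule exI[of _ "ms # mss"]) auto
      done
  qed
qed

section \<open>Message counts of the one-time checks\<close>

text \<open>Only an upper bound, since the checks need not be counted exactly. A \<open>send\<close>
  whose sender lacks the value emits nothing and also satisfies it, so the data flow of the checks
  need not be traced.\<close>

definition emits :: "phase \<Rightarrow> nat \<Rightarrow> (('l, 'h) net, 'a) state \<Rightarrow> bool" where
  "emits ph n m \<longleftrightarrow> yields m (\<lambda>_ ms. length ms \<le> n \<and>
     (\<forall>x\<in>set ms. msg_phase x = ph \<and> msg_stage x = Verification))"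

lemma emits_mono: "emits ph n m \<Longrightarrow> n \<le> n' \<Longrightarrow> emits ph n' m"
  unfolding emits_def by (erule yields_mono) auto

lemma emits_return: "emits ph 0 (State_Monad.return x)"
  unfolding emits_def by (rule yields_return) simp

lemma emits_bind:
  assumes "emits ph n m" and "\<And>x. emits ph n' (f x)" and "\<And>x. keeps_ttp (f x)"
  shows "emits ph (n + n') (State_Monad.bind m f)"
  unfolding emits_def
  apply (rule yields_bind[OF _ assms(3)])
  apply (rule yields_mono[OF assms(1)[unfolded emits_def]])
  apply (rule yields_mono[OF assms(2)[unfolded emits_def]])
  apply auto
  done

lemma emits_send: "emits ph 1 (send A forged c ph Verification i k X)"
  by (auto simp: emits_def yields_def send_def Let_def split: option.split)

lemma emits_establish: "emits ph 0 (establish p b)"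
  by (auto simp: emits_def yields_def establish_def)

lemma emits_case_prod:
  "(\<And>x y. emits ph n (f x y)) \<Longrightarrow> emits ph n (case p of (x, y) \<Rightarrow> f x y)"
  by (cases p) simp

lemma emits_if:
  "emits ph n m \<Longrightarrow> emits ph n' m' \<Longrightarrow> emits ph (max n n') (if b then m else m')"
  by (auto intro: emits_mono)

lemma emits_traverse_list:
  assumes "\<And>x. emits ph n (f x)" and "\<And>x. keeps_ttp (f x)"
  shows "emits ph (length xs * n) (State_Monad.traverse_list f xs)"
  by (induction xs)
    (auto intro!: emits_return emits_bind[where n = n, OF assms(1)] keeps_ttp_intros assms(2)
      intro: emits_bind[where n' = 0, simplified, OF _ emits_return])

lemmas emits_intros = emits_return emits_bind emits_send emits_establish emits_case_prod emits_if

lemma keeps_ttp_jsnd_verify: "keeps_ttp (jsnd_verify Q A ph i j k l insts)"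
  unfolding jsnd_verify_def Let_def by (intro keeps_ttp_intros)

text \<open>One digest, three flags from the receiver and six exchanged flags. The count is
  independent of \<open>insts\<close>, as all instances enter a single hash.\<close>

lemma emits_jsnd_verify: "emits ph 10 (jsnd_verify Q A ph i j k l insts)"
  unfolding jsnd_verify_def Let_def
  \<comment> \<open>\<open>emits_mono\<close> leaves the count schematic; the structural rules build
    it as a sum, which is compared with the bound at the end.\<close>
  by (rule emits_mono, (rule emits_intros keeps_ttp_intros)+) simp

lemma keeps_ttp_vrfyP0_share: "keeps_ttp (vrfyP0_share A C ps r)"
  unfolding vrfyP0_share_def jsh01_def jsh02_def jsh03_def Let_def by (intro keeps_ttp_intros)

lemma emits_vrfyP0_share: "emits Preprocessing 3 (vrfyP0_share A C ps r)"
  unfolding vrfyP0_share_def jsh01_def jsh02_def jsh03_def Let_def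
  by (rule emits_mono, (rule emits_intros keeps_ttp_intros)+) simp

lemma keeps_ttp_rec_share: "keeps_ttp (rec_share Q A ph i j l k X)"
  unfolding rec_share_def Let_def by (intro keeps_ttp_intros)

text \<open>Two ring elements, then either a digest or a third element.\<close>

lemma emits_rec_share: "emits ph 3 (rec_share Q A ph i j l k X)"
  unfolding rec_share_def Let_def
  by (rule emits_mono, (rule emits_intros keeps_ttp_intros)+) simp

lemma keeps_ttp_vrfyP0_check: "keeps_ttp (vrfyP0_check Q A c)"
  unfolding vrfyP0_check_def reconstruct_def Let_def by (intro keeps_ttp_intros keeps_ttp_rec_share)

text \<open>Three messages for the missing share of each of the four parties.\<close>

lemma emits_vrfyP0_check: "emits Preprocessing 12 (vrfyP0_check Q A c)"
  unfolding vrfyP0_check_def reconstruct_def Let_def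
  by (rule emits_mono, (rule emits_intros keeps_ttp_intros keeps_ttp_rec_share emits_rec_share)+) simp

section \<open>Bit lengths of message lists\<close>

definition content_bits :: "('l::len, 'h::len) msg list \<Rightarrow> nat" where
  "content_bits ms = (\<Sum>m\<leftarrow>ms. length (payload_bits (content m)))"

lemma content_bits_simps [simp]:
  "content_bits [] = 0"
  "content_bits (m # ms) = length (payload_bits (content m)) + content_bits ms"
  "content_bits (ms @ ms') = content_bits ms + content_bits ms'"
  by (simp_all add: content_bits_def)

lemma content_bits_concat:
  "\<forall>ms\<in>set mss. content_bits ms = c \<Longrightarrow> content_bits (concat mss) = length mss * c"
  by (induction mss) auto

lemma length_word_bits [simp]: "length (word_bits (w::'l::len word)) = LENGTH('l)"
  by (simp add: word_bits_def)

lemma content_bits_le: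
  fixes ms :: "('l::len, 'h::len) msg list"
  shows "content_bits ms \<le> length ms * (LENGTH('l) + LENGTH('h))"
proof (induction ms)
  case (Cons m ms)
  have "length (payload_bits (content m)) \<le> LENGTH('l) + LENGTH('h)"
    \<comment> \<open>Positivity of the word length covers the single bit of a
      \<open>Flag\<close>.\<close>
    using len_gt_0[where 'a = 'l] by (cases "content m") (auto simp: Suc_le_eq add_pos_pos)
  then show ?case
    using Cons.IH by simp
qed simp

lemma content_bits_le_of_length_le:
  fixes ms :: "('l::len, 'h::len) msg list"
  assumes "length ms \<le> n"
  shows "content_bits ms \<le> n * (LENGTH('l) + LENGTH('h))"
  using content_bits_le[of ms] mult_le_mono1[OF assms] by (rule order_trans)

section \<open>Exact cost of a single multiplication\<close>

text \<open>Only the holders fixed by \<open>sharing_of\<close> matter below: every input share is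
  available at time 0 to its three parties.\<close>

definition shared_gate :: "'l::len gate \<Rightarrow> bool" where
  "shared_gate g \<longleftrightarrow> (\<exists>a b. sharing_of a (inA g) \<and> sharing_of b (inB g))"

text \<open>The interface between the phases: what \<open>P1\<close> and \<open>P2\<close> need for
  their online ring elements. Time 0 is recorded for \<open>pre_u1\<close> and
  \<open>pre_u2\<close>, since it puts \<open>y1\<close> and \<open>y2\<close> into round 1; for the
  shares of the mask of \<open>p\<close>, possession suffices, because that message is
  deferred.\<close>

definition prep_held :: "'l prep \<Rightarrow> bool" where
  "prep_held p \<longleftrightarrow> (\<exists>x. pre_u1 p P1 = Some (0, x)) \<and> (\<exists>x. pre_u2 p P2 = Some (0, x)) \<and>
     pre_p1 p P1 \<noteq> None \<and> pre_p2 p P1 \<noteq> None \<and> pre_p3 p P1 \<noteq> None"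

text \<open>Truncation acts locally on each copy, so holders and times are unchanged. Hence the cost
  is the same for both values of \<open>isTr\<close>.\<close>

lemma trunc_if_eq_Some:
  "X i = Some (t, x) \<Longrightarrow> \<exists>y. trunc_if Q g X i = Some (t, y)"
  by (simp add: trunc_if_def hmap_def)

lemma keeps_ttp_mult_pre: "keeps_ttp (mult_pre Q A C x)"
  unfolding mult_pre_def jsh03_def Let_def by (intro keeps_ttp_intros)

lemma yields_mult_pre:
  fixes A :: "('l::len, 'h::len) adversary"
  assumes "shared_gate (snd x)"
  shows "yields (mult_pre Q A C x) (\<lambda>p ms. prep_held p \<and>
           ((\<forall>m\<in>set ms. msg_phase m = Preprocessing) \<and> content_bits ms = 2 * LENGTH('l)))"
proof -
  obtain n g where x: "x = (n, g)"
    by fastforce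
  note held = hmap_def hmap2_def among_def
  \<comment> \<open>\<open>P0\<close> holds all \<open>lam\<close> shares and all sampled values in
    the preprocessing, so it can compute both messages: the share of \<open>q\<close> for
    \<open>P1\<close> and \<open>w\<close> for \<open>P3\<close>. Folding \<open>q\<close> hides the
    case distinction on \<open>isTr\<close>.\<close>
  define q where
    "q = trunc_if Q g (gamma3 g \<ominus> among {P0, P3, P1} (u1_coin C n) \<ominus> among {P0, P3, P2} (u2_coin C n))"
  have "\<exists>y. (gamma3 g \<ominus> among {P0, P3, P1} (u1_coin C n) \<ominus> among {P0, P3, P2} (u2_coin C n)) P0
      = Some (0, y)"
    using assms by (auto simp: x shared_gate_def sharing_of_def gamma3_def held)
  then obtain y where q: "q P0 = Some (0, y)"
    unfolding q_def using trunc_if_eq_Some by metis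
  obtain l where l: "(hmap uminus q \<ominus> among {P0, P2, P3} (q_coin C n)) P0 = Some (0, l)"
    using q by (auto simp: held)
  obtain w where w: "(gamma1 g \<oplus> gamma2 g \<oplus> (among {P0, P1, P2} (s1_coin C n) \<oplus>
      among {P0, P1, P2} (s2_coin C n))) P0 = Some (0, w)"
    using assms by (auto simp: x shared_gate_def sharing_of_def gamma1_def gamma2_def held)
  show ?thesis
    unfolding x mult_pre_def jsh03_def Let_def prod.case q_def[symmetric]
    apply (intro yields_bind keeps_ttp_intros)
    apply (rule yields_send, rule l)
    apply (rule yields_return)
    apply simp
    apply (intro yields_bind keeps_ttp_intros)
    apply (rule yields_send, rule w)
    apply (rule yields_return)
    apply (simp add: prep_held_def among_def)
    done
qed

lemma keeps_ttp_mult_onl: "keeps_ttp (mult_onl Q A x)"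
  unfolding mult_onl_def Let_def by (intro keeps_ttp_intros)

text \<open>Each of \<open>y1\<close> and \<open>y2\<close> is computed by its sender from copies
  available at time 0, independently of the other message, so both travel in round 1. That
  \<open>P1\<close> ends up holding \<open>onl_p\<close> is what the deferred message to
  \<open>P3\<close> requires.\<close>

lemma yields_mult_onl:
  fixes A :: "('l::len, 'h::len) adversary"
  assumes "shared_gate (fst x)" and "prep_held (snd x)"
  shows "yields (mult_onl Q A x) (\<lambda>r ms. onl_p r P1 \<noteq> None \<and>
           ((\<forall>m\<in>set ms. msg_phase m = Online \<and> msg_stage m = Main \<and> msg_round m = 1) \<and>
            content_bits ms = 2 * LENGTH('l)))"
proof -
  obtain g p where x: "x = (g, p)"
    by fastforce
  note held = hmap_def hmap2_def among_def
  define y1 where "y1 = gamma1 g \<oplus> pre_u1 p \<ominus> lam1 (inA g) \<otimes> masked (inB g)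
    \<ominus> lam1 (inB g) \<otimes> masked (inA g)"
  define y2 where "y2 = gamma2 g \<oplus> pre_u2 p \<ominus> lam2 (inA g) \<otimes> masked (inB g)
    \<ominus> lam2 (inB g) \<otimes> masked (inA g)"
  define y3 where "y3 = hmap uminus (lam3 (inA g) \<otimes> masked (inB g))
    \<ominus> lam3 (inB g) \<otimes> masked (inA g)"
  define mm where "mm = masked (inA g) \<otimes> masked (inB g)"
  obtain v1 where y1: "y1 P1 = Some (0, v1)"
    using assms
    by (auto simp: x y1_def shared_gate_def sharing_of_def prep_held_def gamma1_def held)
  obtain v2 where y2: "y2 P2 = Some (0, v2)"
    using assms
    by (auto simp: x y2_def shared_gate_def sharing_of_def prep_held_def gamma2_def held)
  obtain v3 where y3: "y3 P1 = Some (0, v3)"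
    using assms by (auto simp: x y3_def shared_gate_def sharing_of_def held)
  obtain v4 where mm: "mm P1 = Some (0, v4)"
    using assms by (auto simp: x mm_def shared_gate_def sharing_of_def held)
  have p: "trunc_if Q g X P1 \<noteq> None" if "X P1 \<noteq> None" for X
    using that by (auto simp: trunc_if_def hmap_def)
  show ?thesis
    unfolding x mult_onl_def Let_def prod.case y1_def[symmetric] y2_def[symmetric]
      y3_def[symmetric] mm_def[symmetric]
    apply (intro yields_bind keeps_ttp_intros)
    apply (rule yields_send, rule y1)
    apply (intro yields_bind keeps_ttp_intros)
    apply (rule yields_send, rule y2)
    apply (rule yields_return)
    apply (intro conjI)
      apply (simp only: online.select_convs)
      apply (rule p)
      \<comment> \<open>\<open>P1\<close> combines its own copy of \<open>y1\<close> with the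
        received copy of \<open>y2\<close>.\<close>
      apply (simp add: hmap2_def map_add_def y1 y3 mm)
     apply simp_all
    done
qed

lemma keeps_ttp_jsh12: "keeps_ttp (jsh12 A l1 l2 l3 V)"
  unfolding jsh12_def Let_def by (intro keeps_ttp_intros)

text \<open>This is the third online ring element per multiplication. Its stage is
  \<open>Verification\<close>, so its bits count while its round does not.\<close>

lemma yields_jsh12:
  fixes A :: "('l::len, 'h::len) adversary"
  assumes "l1 P1 \<noteq> None" "l2 P1 \<noteq> None" "l3 P1 \<noteq> None" "V P1 \<noteq> None"
  shows "yields (jsh12 A l1 l2 l3 V) (\<lambda>_ ms.
           (\<forall>m\<in>set ms. msg_phase m = Online \<and> msg_stage m = Verification) \<and>
           content_bits ms = LENGTH('l))"
proof -
  obtain t m where m: "(V \<oplus> (l1 \<oplus> l2 \<oplus> l3)) P1 = Some (t, m)"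
    using assms by (auto simp: hmap2_def)
  show ?thesis
    unfolding jsh12_def Let_def
    apply (intro yields_bind keeps_ttp_intros)
    apply (rule yields_send, rule m)
    apply (rule yields_return)
    apply simp
    done
qed

section \<open>Cost of each phase\<close>

lemma list_all2_constD:
  "list_all2 (\<lambda>_. R) xs ys \<Longrightarrow> length ys = length xs \<and> (\<forall>y\<in>set ys. R y)"
  by (induction rule: list_all2_induct) auto

text \<open>The factor \<open>15 * kappa Q + 30\<close> bounds the number of check messages: 3 for
  sharing and 12 for reconstruction per repetition, and 10 for each of the three joint-send
  verifications. The other factor bounds the bits of one message.\<close>

lemma yields_preprocessing:
  fixes Q :: "'h::len params" and A :: "('l::len, 'h) adversary"
  assumes "\<forall>g\<in>set gs. shared_gate g"
  shows "yields (preprocessing Q A C gs) (\<lambda>ps ms. length ps = length gs \<and> (\<forall>p\<in>set ps. prep_held p) \<and>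
           (\<forall>m\<in>set ms. msg_phase m = Preprocessing) \<and>
           (\<exists>e\<le>(15 * kappa Q + 30) * (LENGTH('l) + LENGTH('h)).
              content_bits ms = 2 * LENGTH('l) * length gs + e))"
proof -
  have gates: "shared_gate (snd x)" if "x \<in> set (enumerate 0 gs)" for x
    using assms that by (cases x) (auto simp: in_set_enumerate_eq)
  let ?checks = "\<lambda>n ms. length ms \<le> n \<and>
    (\<forall>m\<in>set ms. msg_phase m = Preprocessing \<and> msg_stage m = Verification)"
  have main: "yields (State_Monad.traverse_list (mult_pre Q A C) (enumerate 0 gs)) (\<lambda>ps ms.
      length ps = length gs \<and> (\<forall>p\<in>set ps. prep_held p) \<and>
      (\<forall>m\<in>set ms. msg_phase m = Preprocessing) \<and> content_bits ms = 2 * LENGTH('l) * length gs)"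
    apply (rule yields_mono)
     apply (rule yields_traverse_list)
      apply (erule yields_mult_pre[OF gates])
     apply (rule keeps_ttp_mult_pre)
    apply (auto dest!: list_all2_constD simp: content_bits_concat[where c = "2 * LENGTH('l)"])
    done
  \<comment> \<open>The length of \<open>cs\<close> is retained because the later bound for the
    checks is \<open>length cs * 12\<close>.\<close>
  have shares: "yields (State_Monad.traverse_list (vrfyP0_share A C ps) [0..<kappa Q])
      (\<lambda>cs ms. length cs = kappa Q \<and> ?checks (kappa Q * 3) ms)" for ps :: "'l prep list"
  proof (rule yields_mono)
    show "yields (State_Monad.traverse_list (vrfyP0_share A C ps) [0..<kappa Q])
      (\<lambda>cs ms. list_all2 (\<lambda>_ _. True) [0..<kappa Q] cs \<and> (\<exists>mss. ms = concat mss \<and>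
         length mss = length [0..<kappa Q] \<and> (\<forall>ms\<in>set mss. ?checks 3 ms)))"
      using emits_vrfyP0_share unfolding emits_def
      by (intro yields_traverse_list keeps_ttp_vrfyP0_share) simp
  next
    fix cs :: "'l check list" and ms :: "('l, 'h) msg list"
    assume "list_all2 (\<lambda>_ _. True) [0..<kappa Q] cs \<and> (\<exists>mss. ms = concat mss \<and>
         length mss = length [0..<kappa Q] \<and> (\<forall>ms\<in>set mss. ?checks 3 ms))"
    moreover have "length (concat mss) \<le> length mss * 3" if "\<forall>ms\<in>set mss. length ms \<le> 3"
      for mss :: "('l, 'h) msg list list"
      using that by (induction mss) auto
    ultimately show "length cs = kappa Q \<and> ?checks (kappa Q * 3) ms"
      by (fastforce dest: list_all2_lengthD)
  qed
  have bound: "\<exists>e\<le>(15 * kappa Q + 30) * (LENGTH('l) + LENGTH('h)).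
      content_bits ms = 2 * LENGTH('l) * length gs + e"
    if "ms = ms1 @ ms2" "content_bits ms1 = 2 * LENGTH('l) * length gs"
      "length ms2 \<le> 15 * kappa Q + 30" for ms ms1 ms2 :: "('l, 'h) msg list"
    using that(1,2) content_bits_le_of_length_le[OF that(3)]
    by (intro exI[of _ "content_bits ms2"] conjI) simp_all
  note keeps_ttp = keeps_ttp_intros keeps_ttp_mult_pre keeps_ttp_vrfyP0_share
    keeps_ttp_jsnd_verify keeps_ttp_vrfyP0_check
  show ?thesis
    unfolding preprocessing_def
    apply (intro yields_bind keeps_ttp)
    apply (rule yields_mono[OF main])
    apply (intro yields_bind keeps_ttp)
    apply (rule yields_mono[OF shares])
    apply (intro yields_bind keeps_ttp)
    apply (rule yields_mono[OF emits_jsnd_verify[unfolded emits_def]])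
    apply (intro yields_bind keeps_ttp)
    apply (rule yields_mono[OF emits_jsnd_verify[unfolded emits_def]])
    apply (intro yields_bind keeps_ttp)
    apply (rule yields_mono[OF emits_jsnd_verify[unfolded emits_def]])
    apply (intro yields_bind keeps_ttp)
    apply (rule yields_mono[OF emits_traverse_list[OF emits_vrfyP0_check keeps_ttp_vrfyP0_check,
        unfolded emits_def]])
    apply (rule yields_return)
    apply (intro conjI)
       apply blast
      apply blast
     apply auto[1]
    apply (rule bound[OF refl])
     apply blast
    apply simp
    done
qed

lemma keeps_ttp_online: "keeps_ttp (online Q A gs ps)"
  unfolding online_def Let_def
  by (intro keeps_ttp_intros keeps_ttp_mult_onl keeps_ttp_jsh12 keeps_ttp_jsnd_verify)

text \<open>Per multiplication, two elements come from \<open>mult_onl\<close> and one from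
  \<open>jsh12\<close>. The 12 remaining messages are the 10 of the joint-send verification and the
  two digests from \<open>P3\<close>.\<close>

lemma yields_online:
  fixes Q :: "'h::len params" and A :: "('l::len, 'h) adversary"
  assumes "\<forall>g\<in>set gs. shared_gate g" and "\<forall>p\<in>set ps. prep_held p"
    and len: "length ps = length gs"
  shows "yields (online Q A gs ps) (\<lambda>_ ms.
           (\<forall>m\<in>set ms. msg_phase m = Online \<and> (msg_stage m = Main \<longrightarrow> msg_round m = 1)) \<and>
           (gs \<noteq> [] \<longrightarrow> (\<exists>m\<in>set ms. msg_stage m = Main)) \<and>
           (\<exists>e\<le>12 * (LENGTH('l) + LENGTH('h)). content_bits ms = 3 * LENGTH('l) * length gs + e))"
proof -
  have main: "yields (State_Monad.traverse_list (mult_onl Q A) (zip gs ps)) (\<lambda>os ms.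
      length os = length gs \<and> (\<forall>r\<in>set os. onl_p r P1 \<noteq> None) \<and>
      (\<forall>m\<in>set ms. msg_phase m = Online \<and> msg_stage m = Main \<and> msg_round m = 1) \<and>
      content_bits ms = 2 * LENGTH('l) * length gs)"
  proof (rule yields_mono)
    show "yields (State_Monad.traverse_list (mult_onl Q A) (zip gs ps)) (\<lambda>os ms.
        list_all2 (\<lambda>_ r. onl_p r P1 \<noteq> None) (zip gs ps) os \<and> (\<exists>mss. ms = concat mss \<and>
        length mss = length (zip gs ps) \<and> (\<forall>ms\<in>set mss.
         (\<forall>m\<in>set ms. msg_phase m = Online \<and> msg_stage m = Main \<and> msg_round m = 1) \<and>
         content_bits ms = 2 * LENGTH('l))))"
      using assms
      by (intro yields_traverse_list keeps_ttp_mult_onl yields_mult_onl)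
        (auto dest: in_set_zipE)
  qed (auto dest!: list_all2_constD simp: content_bits_concat[where c = "2 * LENGTH('l)"] len)
  have masks: "yields (State_Monad.traverse_list
        (\<lambda>(p, r). jsh12 A (pre_p1 p) (pre_p2 p) (pre_p3 p) (onl_p r)) (zip ps os)) (\<lambda>_ ms.
      (\<forall>m\<in>set ms. msg_phase m = Online \<and> msg_stage m = Verification) \<and>
      content_bits ms = LENGTH('l) * length gs)"
    if "length os = length gs" "\<forall>r\<in>set os. onl_p r P1 \<noteq> None" for os :: "'l online list"
  proof (rule yields_mono)
    show "yields (State_Monad.traverse_list
        (\<lambda>(p, r). jsh12 A (pre_p1 p) (pre_p2 p) (pre_p3 p) (onl_p r)) (zip ps os)) (\<lambda>js ms.
        list_all2 (\<lambda>_ _. True) (zip ps os) js \<and> (\<exists>mss. ms = concat mss \<and>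
        length mss = length (zip ps os) \<and> (\<forall>ms\<in>set mss.
         (\<forall>m\<in>set ms. msg_phase m = Online \<and> msg_stage m = Verification) \<and>
         content_bits ms = LENGTH('l))))"
    proof (intro yields_traverse_list keeps_ttp_case_prod keeps_ttp_jsh12)
      fix x
      assume x: "x \<in> set (zip ps os)"
      obtain p r where pr: "x = (p, r)"
        by fastforce
      have "prep_held p" "onl_p r P1 \<noteq> None"
        using x that(2) assms(2) by (auto simp: pr dest: in_set_zipE)
      then show "yields (case x of (p, r) \<Rightarrow> jsh12 A (pre_p1 p) (pre_p2 p) (pre_p3 p) (onl_p r))
        (\<lambda>_ ms. True \<and> (\<forall>m\<in>set ms. msg_phase m = Online \<and> msg_stage m = Verification) \<and>
          content_bits ms = LENGTH('l))"
        unfolding pr prod.case simp_thms by (intro yields_jsh12) (auto simp: prep_held_def)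
    qed
  qed (auto simp: content_bits_concat[where c = "LENGTH('l)"] len that(1))
  \<comment> \<open>Since the word length is positive, a nonzero number of bits forces a message to
    exist.\<close>
  have ex_main: "\<exists>m\<in>set ms. msg_stage m = Main"
    if "gs \<noteq> []" "content_bits ms = 2 * LENGTH('l) * length gs" "\<forall>m\<in>set ms. msg_stage m = Main"
    for ms :: "('l, 'h) msg list"
    using that by (cases ms) auto
  have bound: "\<exists>e\<le>12 * (LENGTH('l) + LENGTH('h)).
      content_bits (ms1 @ ms2 @ ms3) = 3 * LENGTH('l) * length gs + e"
    if "content_bits ms1 = 2 * LENGTH('l) * length gs" "content_bits ms2 = LENGTH('l) * length gs"
      "length ms3 \<le> 12" for ms1 ms2 ms3 :: "('l, 'h) msg list"
    using that(1,2) content_bits_le_of_length_le[OF that(3)]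
    by (intro exI[of _ "content_bits ms3"] conjI) simp_all
  show ?thesis
    unfolding online_def Let_def
    apply (intro yields_bind keeps_ttp_intros keeps_ttp_mult_onl keeps_ttp_jsh12
        keeps_ttp_jsnd_verify)
    apply (rule yields_mono[OF main])
    apply (intro yields_bind keeps_ttp_intros keeps_ttp_jsh12 keeps_ttp_jsnd_verify)
    apply (rule yields_mono[OF masks])
      apply blast
     apply blast
    subgoal for os ms1 js ms2
      apply (rule yields_mono)
       \<comment> \<open>Everything after the masked values is bounded in one piece.\<close>
       apply (rule emits_mono[of _ _ _ 12, unfolded emits_def[of _ 12]])
        apply (rule emits_intros keeps_ttp_intros keeps_ttp_jsnd_verify emits_jsnd_verify)+
       apply simp
      apply (intro conjI impI)
        apply auto[1]
       apply (frule ex_main)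
         apply blast
        apply blast
       apply fastforce
      apply (rule bound)
        apply blast
       apply blast
      apply blast
      done
    done
qed

section \<open>Complete executions and the amortized limit\<close>

lemma execution_sent:
  fixes Q :: "'h::len params" and A :: "('l::len, 'h) adversary"
  assumes "\<forall>g\<in>set gs. shared_gate g" and "ttp (execution Q A C gs) = None"
  shows "\<exists>pre onl. sent (execution Q A C gs) = pre @ onl \<and>
    (\<forall>m\<in>set pre. msg_phase m = Preprocessing) \<and>
    (\<exists>e\<le>(15 * kappa Q + 30) * (LENGTH('l) + LENGTH('h)).
       content_bits pre = 2 * LENGTH('l) * length gs + e) \<and>
    (\<forall>m\<in>set onl. msg_phase m = Online \<and> (msg_stage m = Main \<longrightarrow> msg_round m = 1)) \<and>
    (gs \<noteq> [] \<longrightarrow> (\<exists>m\<in>set onl. msg_stage m = Main)) \<and>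
    (\<exists>e\<le>12 * (LENGTH('l) + LENGTH('h)). content_bits onl = 3 * LENGTH('l) * length gs + e)"
    (is "?P (sent (execution Q A C gs))")
proof -
  have "yields (mult_protocol Q A C gs) (\<lambda>_. ?P)"
    unfolding mult_protocol_def
    apply (intro yields_bind keeps_ttp_online)
    apply (rule yields_mono[OF yields_preprocessing[OF assms(1)]])
    apply (rule yields_mono[OF yields_online[OF assms(1)]])
      apply blast
     apply blast
    apply blast
    done
  from yieldsD[OF this, of "\<lparr>sent = [], ttp = None\<rparr>"] assms(2) show ?thesis
    by (simp add: execution_def)
qed

text \<open>The quotient lies between \<open>c\<close> and \<open>c + K / M\<close> for positive
  \<open>M\<close>, and \<open>K\<close> does not depend on \<open>M\<close>.\<close>

lemma tendsto_amortized:
  fixes f :: "nat \<Rightarrow> nat"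
  assumes "\<And>M. \<exists>e\<le>K. f M = c * M + e"
  shows "(\<lambda>M. real (f M) / real M) \<longlonglongrightarrow> real c"
proof (rule real_tendsto_sandwich)
  show "\<forall>\<^sub>F M in sequentially. real c \<le> real (f M) / real M"
    using eventually_gt_at_top[of 0]
  proof eventually_elim
    case (elim M)
    then show ?case
      using assms[of M] by (auto simp: field_simps)
  qed
  show "\<forall>\<^sub>F M in sequentially. real (f M) / real M \<le> real c + real K / real M"
    using eventually_gt_at_top[of 0]
  proof eventually_elim
    case (elim M)
    then show ?case
      using assms[of M] by (auto simp: field_simps)
  qed
  have "(\<lambda>M. real c + real K / real M) \<longlonglongrightarrow> real c + 0"
    by (intro tendsto_intros lim_const_over_n)
  then show "(\<lambda>M. real c + real K / real M) \<longlonglongrightarrow> real c"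
    by simp
qed simp

lemma image_eq_singletonI: "x \<in> A \<Longrightarrow> (\<And>y. y \<in> A \<Longrightarrow> f y = c) \<Longrightarrow> f ` A = {c}"
  by force

theorem lemmaB5:
  fixes Q :: "'h::len params"
    and A :: "nat \<Rightarrow> ('l::len, 'h::len) adversary"
    and C :: "nat \<Rightarrow> 'l::len coins"
    and gs :: "nat \<Rightarrow> 'l::len gate list"
  assumes "\<And>M. length (gs M) = M"
    and "\<And>M g. g \<in> set (gs M) \<Longrightarrow> \<exists>a b. sharing_of a (inA g) \<and> sharing_of b (inB g)"
    and "\<And>M. ttp (execution Q (A M) (C M) (gs M)) = None"
  shows "(\<lambda>M. real (comm_bits Preprocessing (execution Q (A M) (C M) (gs M))) / real M)
           \<longlonglongrightarrow> 2 * real LENGTH('l)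
       \<and> (\<lambda>M. real (comm_bits Online (execution Q (A M) (C M) (gs M))) / real M)
           \<longlonglongrightarrow> 3 * real LENGTH('l)
       \<and> (\<forall>M\<ge>1. comm_rounds Online (execution Q (A M) (C M) (gs M)) = 1)"
proof -
  let ?N = "\<lambda>M. execution Q (A M) (C M) (gs M)"
  have gates: "\<forall>g\<in>set (gs M). shared_gate g" for M
    using assms(2) by (auto simp: shared_gate_def)
  \<comment> \<open>The overhead bounds depend only on \<open>kappa Q\<close> and the two word
    lengths, so they are uniform in \<open>M\<close> although adversary, coins and gates vary with
    it.\<close>
  have pre_bits: "\<exists>e\<le>(15 * kappa Q + 30) * (LENGTH('l) + LENGTH('h)).
      comm_bits Preprocessing (?N M) = 2 * LENGTH('l) * M + e"
    and onl_bits: "\<exists>e\<le>12 * (LENGTH('l) + LENGTH('h)).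
      comm_bits Online (?N M) = 3 * LENGTH('l) * M + e"
    and rounds: "M \<ge> 1 \<Longrightarrow> comm_rounds Online (?N M) = 1" for M
  proof -
    from execution_sent[OF gates assms(3), of M] obtain pre onl where
      sent: "sent (?N M) = pre @ onl" and pre: "\<forall>m\<in>set pre. msg_phase m = Preprocessing"
      and pre_bits: "\<exists>e\<le>(15 * kappa Q + 30) * (LENGTH('l) + LENGTH('h)).
           content_bits pre = 2 * LENGTH('l) * length (gs M) + e"
      and onl: "\<forall>m\<in>set onl. msg_phase m = Online \<and> (msg_stage m = Main \<longrightarrow> msg_round m = 1)"
      and main: "gs M \<noteq> [] \<longrightarrow> (\<exists>m\<in>set onl. msg_stage m = Main)"
      and onl_bits: "\<exists>e\<le>12 * (LENGTH('l) + LENGTH('h)).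
           content_bits onl = 3 * LENGTH('l) * length (gs M) + e"
      by blast
    have filters: "filter (\<lambda>m. msg_phase m = Preprocessing) (sent (?N M)) = pre"
      "filter (\<lambda>m. msg_phase m = Online) (sent (?N M)) = onl"
      using pre onl by (auto simp: sent filter_empty_conv)
    show "\<exists>e\<le>(15 * kappa Q + 30) * (LENGTH('l) + LENGTH('h)).
        comm_bits Preprocessing (?N M) = 2 * LENGTH('l) * M + e"
      using pre_bits by (simp add: comm_bits_def filters content_bits_def assms(1))
    show "\<exists>e\<le>12 * (LENGTH('l) + LENGTH('h)). comm_bits Online (?N M) = 3 * LENGTH('l) * M + e"
      using onl_bits by (simp add: comm_bits_def filters content_bits_def assms(1))
    show "comm_rounds Online (?N M) = 1" if "M \<ge> 1"
    proof -
      have "gs M \<noteq> []"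
        using that assms(1)[of M] by auto
      then obtain m where m: "m \<in> set onl" "msg_stage m = Main"
        using main by blast
      let ?R = "{m \<in> set (sent (?N M)). msg_phase m = Online \<and> msg_stage m = Main}"
      have "m \<in> ?R"
        using m onl by (simp add: sent)
      moreover have "msg_round x = 1" if "x \<in> ?R" for x
        using that pre onl by (auto simp: sent)
      \<comment> \<open>Nonemptiness matters: without a \<open>Main\<close> message the inserted 0
        would be the maximum, hence the restriction to \<open>M \<ge> 1\<close>.\<close>
      ultimately have "msg_round ` ?R = {1}"
        by (rule image_eq_singletonI)
      then show ?thesis
        by (simp add: comm_rounds_def)
    qed
  qed
  from tendsto_amortized[OF pre_bits] tendsto_amortized[OF onl_bits] rounds show ?thesis
    by simp
qed

end
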